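(* Let $X$ be a non-empty complete metric space, $Y$ a separable metric space, and $T_n:X\to Y$, $n\geq 0$, continuous mappings. Let $\mathcal{A} = \bigcup_{\delta\in D}\mathcal{A}_\delta$ with $\mathcal{A}_\delta=\bigcap_{\mu\in M} \mathcal{A}_{\delta,\mu}$ be an upper Furstenberg family. Consider the following assertions: (a) for any non-empty open subset $V$ of $Y$ there is some $\delta\in D$ such that for any non-empty open subset $U$ of $X$ there is some $x\in U$ such that $\{n\geq 0 : T_n x\in V\} \in \mathcal{A}_\delta$; (b) for any non-empty open subset $V$ of $Y$ there is some $\delta\in D$ such that for any non-empty open subset $U$ of $X$ and any $\mu\in M$ there is some $x\in U$ such that $\{n\geq 0 : T_n x\in V\} \in \mathcal{A}_{\delta,\mu}$; (c) the set of $\mathcal{A}$-universal points for $(T_n)$ is residual in $X$; (d) $(T_n)$ admits an $\mathcal{A}$-universal point. Then (a) $\Longrightarrow$ (b) $\Longrightarrow$ (c) $\Longrightarrow$ (d). Moreover, if $X=Y$ and $T_n=T^n$, $n\geq 0$, for some continuous mapping $T:X\to X$, then the four assertions are equivalent.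
   Context: Let $\mathbb{N}_0=\{0,1,2,\ldots\}$. For $A\subset\mathbb{N}_0$ and $n\geq 0$, $A-n=\{k-n : k\in A, k\geq n\}$. A Furstenberg family is a non-empty family $\mathcal{A}$ of subsets of $\mathbb{N}_0$ that is hereditary upward: $A\in\mathcal{A}$, $B\supset A$ imply $B\in\mathcal{A}$. It is proper if $\varnothing\notin\mathcal{A}$. A Furstenberg family $\mathcal{A}$ is called upper if it is proper and it can be written as $\mathcal{A} = \bigcup_{\delta\in D} \mathcal{A}_{\delta}$ with $\mathcal{A}_{\delta}=\bigcap_{\mu\in M} \mathcal{A}_{\delta,\mu}$ for some families $\mathcal{A}_{\delta,\mu}$ of subsets of $\mathbb{N}_0$ ($\delta\in D,\mu\in M$), where the index set $D$ is arbitrary but $M$ is countable, and such that: (i) each $\mathcal{A}_{\delta,\mu}$ is finitely hereditary upward, that is, for any $A\in \mathcal{A}_{\delta,\mu}$ there is a finite set $F\subset\mathbb{N}_0$ such that $B\supset A\cap F$ implies $B\in\mathcal{A}_{\delta,\mu}$; (ii) $\mathcal{A}$ is uniformly left-invariant, that is, for any $A\in \mathcal{A}$ there is some $\delta\in D$ such that, for all $n\geq 0$, $A-n\in \mathcal{A}_\delta$. A point $x\in X$ is called $\mathcal{A}$-universal for $(T_n)$ if, for any non-empty open set $U$ in $Y$, $\{ n\geq 0 : T_nx\in U\}\in \mathcal{A}$. A subset of $X$ is residual if it contains a countable intersection of dense open subsets of $X$. *)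

theory Defs
  imports "HOL-Analysis.Analysis"
begin

definition left_shift :: "nat set \<Rightarrow> nat \<Rightarrow> nat set" where
  "left_shift A n = {k - n | k. k \<in> A \<and> n \<le> k}"

definition furstenberg_family :: "nat set set \<Rightarrow> bool" where
  "furstenberg_family \<A> \<longleftrightarrow> \<A> \<noteq> {} \<and> (\<forall>A\<in>\<A>. \<forall>B. A \<subseteq> B \<longrightarrow> B \<in> \<A>)"

definition proper_family :: "nat set set \<Rightarrow> bool" where
  "proper_family \<A> \<longleftrightarrow> {} \<notin> \<A>"

definition finitely_hereditary_upward :: "nat set set \<Rightarrow> bool" where
  "finitely_hereditary_upward \<F> \<longleftrightarrow>
     (\<forall>A\<in>\<F>. \<exists>F. finite F \<and> (\<forall>B. A \<inter> F \<subseteq> B \<longrightarrow> B \<in> \<F>))"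

definition subfamily :: "'m set \<Rightarrow> ('d \<Rightarrow> 'm \<Rightarrow> nat set set) \<Rightarrow> 'd \<Rightarrow> nat set set" where
  "subfamily M \<F> \<delta> = (\<Inter>\<mu>\<in>M. \<F> \<delta> \<mu>)"

text \<open>
  \<open>\<A>\<close> is an upper Furstenberg family, together with a chosen representation
  \<open>\<A> = (\<Union>\<delta>\<in>D. \<Inter>\<mu>\<in>M. \<F> \<delta> \<mu>)\<close> witnessing this. The representation is a parameter rather than
  existentially quantified, because properties of sequences of mappings are formulated in
  terms of it.
\<close>
definition upper_furstenberg_family ::
    "'d set \<Rightarrow> 'm set \<Rightarrow> ('d \<Rightarrow> 'm \<Rightarrow> nat set set) \<Rightarrow> nat set set \<Rightarrow> bool" where
  "upper_furstenberg_family D M \<F> \<A> \<longleftrightarrow>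
     furstenberg_family \<A> \<and> proper_family \<A> \<and>
     countable M \<and> \<A> = (\<Union>\<delta>\<in>D. subfamily M \<F> \<delta>) \<and>
     (\<forall>\<delta>\<in>D. \<forall>\<mu>\<in>M. finitely_hereditary_upward (\<F> \<delta> \<mu>)) \<and>
     (\<forall>A\<in>\<A>. \<exists>\<delta>\<in>D. \<forall>n. left_shift A n \<in> subfamily M \<F> \<delta>)"

definition return_set :: "(nat \<Rightarrow> 'x \<Rightarrow> 'y) \<Rightarrow> 'x \<Rightarrow> 'y set \<Rightarrow> nat set" where
  "return_set T x V = {n. T n x \<in> V}"

definition universal_point ::
    "nat set set \<Rightarrow> (nat \<Rightarrow> 'x \<Rightarrow> 'y::topological_space) \<Rightarrow> 'x \<Rightarrow> bool" where
  "universal_point \<A> T x \<longleftrightarrow> (\<forall>U. open U \<and> U \<noteq> {} \<longrightarrow> return_set T x U \<in> \<A>)"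

definition residual :: "'x::topological_space set \<Rightarrow> bool" where
  "residual S \<longleftrightarrow>
     (\<exists>\<G>. countable \<G> \<and> (\<forall>G\<in>\<G>. open G \<and> closure G = UNIV) \<and> \<Inter>\<G> \<subseteq> S)"

definition hits_subfamily ::
    "'d set \<Rightarrow> 'm set \<Rightarrow> ('d \<Rightarrow> 'm \<Rightarrow> nat set set) \<Rightarrow>
     (nat \<Rightarrow> 'x::topological_space \<Rightarrow> 'y::topological_space) \<Rightarrow> bool" where
  "hits_subfamily D M \<F> T \<longleftrightarrow>
     (\<forall>V. open V \<and> V \<noteq> {} \<longrightarrow>
       (\<exists>\<delta>\<in>D. \<forall>U. open U \<and> U \<noteq> {} \<longrightarrow> (\<exists>x\<in>U. return_set T x V \<in> subfamily M \<F> \<delta>)))"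

definition hits_components ::
    "'d set \<Rightarrow> 'm set \<Rightarrow> ('d \<Rightarrow> 'm \<Rightarrow> nat set set) \<Rightarrow>
     (nat \<Rightarrow> 'x::topological_space \<Rightarrow> 'y::topological_space) \<Rightarrow> bool" where
  "hits_components D M \<F> T \<longleftrightarrow>
     (\<forall>V. open V \<and> V \<noteq> {} \<longrightarrow>
       (\<exists>\<delta>\<in>D. \<forall>U. open U \<and> U \<noteq> {} \<longrightarrow> (\<forall>\<mu>\<in>M. \<exists>x\<in>U. return_set T x V \<in> \<F> \<delta> \<mu>)))"

end

theory Submission
  imports Defs
begin

text \<open>
  The argument is a Baire category argument in the style of Birkhoff's transitivity theorem.

  Finite upward heredity says that membership of a return set in \<open>\<F> \<delta> \<mu>\<close> is certified by finitely
  many of its elements. By continuity of the maps the same finitely many returns occur at all nearby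
  points, so the set of points whose return set to a fixed open set lies in \<open>\<F> \<delta> \<mu>\<close> is open
  (\<open>open_return_set_finitely_hereditary\<close>), and
  \<open>hits_components\<close> says exactly that these sets are dense, with \<open>\<delta>\<close> depending on the target set
  alone. As \<open>M\<close> and a base of \<open>Y\<close> are countable, only countably many
  such sets occur, and any point in all of them is universal
  (\<open>hits_components_imp_residual_universal\<close>). Baire's theorem then yields a universal point.

  For the iterates of one map, let \<open>x\<close> be universal. Its return set \<open>A\<close> to \<open>V\<close> lies in \<open>\<A>\<close>, and
  uniform left-invariance provides one \<open>\<delta>\<close> that serves all shifts of \<open>A\<close>. These shifts are the return
  sets to \<open>V\<close> of the points on the orbit of \<open>x\<close>. Since \<open>\<A>\<close> is proper, universality makes the orbit
  dense, so every non-empty open set contains one of these points, as \<open>hits_subfamily\<close> requires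
  (\<open>universal_point_funpow_imp_hits_subfamily\<close>).
\<close>

lemma separable_metric_countable_base:
  assumes "separable_space (euclidean :: 'y::metric_space topology)"
  obtains \<B> :: "'y::metric_space set set" where "countable \<B>" "\<And>B. B \<in> \<B> \<Longrightarrow> open B \<and> B \<noteq> {}"
    "\<And>U. open U \<Longrightarrow> U \<noteq> {} \<Longrightarrow> \<exists>B\<in>\<B>. B \<subseteq> U"
proof -
  obtain C :: "'y set" where C: "countable C" "closure C = UNIV"
    using assms unfolding separable_space_def by auto
  define \<B> where "\<B> = (\<lambda>(c, n). ball c (1 / real (Suc n))) ` (C \<times> (UNIV :: nat set))"
  show thesis
  proof
    show "countable \<B>"
      unfolding \<B>_def using C(1) by auto
    show "open B \<and> B \<noteq> {}" if "B \<in> \<B>" for B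
      using that unfolding \<B>_def by (auto simp: divide_simps)
    show "\<exists>B\<in>\<B>. B \<subseteq> U" if U: "open U" "U \<noteq> {}" for U :: "'y set"
    proof -
      from C(2) U obtain c where c: "c \<in> C" "c \<in> U"
        using open_Int_closure_eq_empty[of U C] by auto
      then obtain e where e: "e > 0" "ball c e \<subseteq> U"
        using U(1) open_contains_ball by blast
      obtain n where "1 / real (Suc n) < e"
        using e(1) nat_approx_posE by blast
      then have "ball c (1 / real (Suc n)) \<subseteq> U"
        using e(2) subset_ball[of "1 / real (Suc n)" e c] by auto
      with c show ?thesis
        unfolding \<B>_def by (intro bexI[of _ "ball c (1 / real (Suc n))"]) auto
    qed
  qed
qed

text \<open>
  The finite part of the return set that certifies membership is a finite set of conditions
  \<open>T n x \<in> V\<close>, each of them open in \<open>x\<close>.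
\<close>
lemma open_return_set_finitely_hereditary:
  fixes T :: "nat \<Rightarrow> 'x::topological_space \<Rightarrow> 'y::topological_space"
  assumes "finitely_hereditary_upward \<H>" and "\<And>n. continuous_on UNIV (T n)" and "open V"
  shows "open {x. return_set T x V \<in> \<H>}"
proof (subst open_subopen, intro ballI)
  fix x assume "x \<in> {x. return_set T x V \<in> \<H>}"
  then obtain F where F: "finite F" "\<And>B. return_set T x V \<inter> F \<subseteq> B \<Longrightarrow> B \<in> \<H>"
    using assms(1) unfolding finitely_hereditary_upward_def by blast
  define W where "W = (\<Inter>n \<in> return_set T x V \<inter> F. T n -` V)"
  have "open W"
    unfolding W_def using F(1) assms(2,3) by (intro open_INT) (auto intro: open_vimage)
  moreover have "x \<in> W"
    unfolding W_def return_set_def by auto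
  moreover have "W \<subseteq> {x. return_set T x V \<in> \<H>}"
  proof
    fix y assume "y \<in> W"
    then have "return_set T x V \<inter> F \<subseteq> return_set T y V"
      unfolding W_def return_set_def by auto
    then show "y \<in> {x. return_set T x V \<in> \<H>}"
      using F(2) by auto
  qed
  ultimately show "\<exists>W. open W \<and> x \<in> W \<and> W \<subseteq> {x. return_set T x V \<in> \<H>}"
    by blast
qed

lemma hits_subfamily_imp_hits_components:
  "hits_subfamily D M \<F> T \<Longrightarrow> hits_components D M \<F> T"
  unfolding hits_subfamily_def hits_components_def subfamily_def by (metis INT_E)

text \<open>
  The order of quantifiers in \<open>hits_components\<close> is what makes this work: \<open>\<delta>\<close> is chosen for each basic open set \<open>B\<close>
  before \<open>U\<close> and \<open>\<mu>\<close>, so each pair \<open>(B, \<mu>)\<close> contributes a single dense open set.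
\<close>
lemma hits_components_imp_residual_universal:
  fixes T :: "nat \<Rightarrow> 'x::topological_space \<Rightarrow> 'y::metric_space"
  assumes upper: "upper_furstenberg_family D M \<F> \<A>"
    and sep: "separable_space (euclidean :: 'y topology)"
    and cont: "\<And>n. continuous_on UNIV (T n)"
    and hits: "hits_components D M \<F> T"
  shows "residual {x. universal_point \<A> T x}"
proof -
  obtain \<B> :: "'y set set" where \<B>: "countable \<B>" "\<And>B. B \<in> \<B> \<Longrightarrow> open B \<and> B \<noteq> {}"
    "\<And>U. open U \<Longrightarrow> U \<noteq> {} \<Longrightarrow> \<exists>B\<in>\<B>. B \<subseteq> U"
    using separable_metric_countable_base[OF sep] by blast
  have "\<forall>B\<in>\<B>. \<exists>\<delta>\<in>D. \<forall>U. open U \<and> U \<noteq> {} \<longrightarrow> (\<forall>\<mu>\<in>M. \<exists>x\<in>U. return_set T x B \<in> \<F> \<delta> \<mu>)"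
    using hits[unfolded hits_components_def, rule_format] \<B>(2) by simp
  then obtain d where d: "\<And>B. B \<in> \<B> \<Longrightarrow> d B \<in> D"
    "\<And>B U \<mu>. B \<in> \<B> \<Longrightarrow> open U \<Longrightarrow> U \<noteq> {} \<Longrightarrow> \<mu> \<in> M \<Longrightarrow> \<exists>x\<in>U. return_set T x B \<in> \<F> (d B) \<mu>"
    by metis
  define G where "G B \<mu> = {x. return_set T x B \<in> \<F> (d B) \<mu>}" for B \<mu>
  have "countable ((\<lambda>(B, \<mu>). G B \<mu>) ` (\<B> \<times> M))"
    using \<B>(1) upper unfolding upper_furstenberg_family_def by auto
  moreover have "open (G B \<mu>) \<and> closure (G B \<mu>) = UNIV" if "B \<in> \<B>" "\<mu> \<in> M" for B \<mu>
  proof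
    show "open (G B \<mu>)"
      unfolding G_def using upper that d(1) \<B>(2) cont
      by (intro open_return_set_finitely_hereditary) (auto simp: upper_furstenberg_family_def)
    \<comment> \<open>If \<open>G B \<mu>\<close> were not dense, it would miss the non-empty open complement of its closure.\<close>
    show "closure (G B \<mu>) = UNIV"
      using d(2)[OF that(1) _ _ that(2), of "- closure (G B \<mu>)"] closure_subset[of "G B \<mu>"]
      by (auto simp: G_def)
  qed
  moreover have "universal_point \<A> T x" if x: "\<And>B \<mu>. B \<in> \<B> \<Longrightarrow> \<mu> \<in> M \<Longrightarrow> x \<in> G B \<mu>" for x
    unfolding universal_point_def
  proof (intro allI impI)
    fix U :: "'y set" assume "open U \<and> U \<noteq> {}"
    then obtain B where B: "B \<in> \<B>" "B \<subseteq> U"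
      using \<B>(3) by blast
    then have "return_set T x B \<in> subfamily M \<F> (d B)"
      using x unfolding G_def subfamily_def by blast
    then have "return_set T x B \<in> \<A>"
      using upper d(1)[OF B(1)] unfolding upper_furstenberg_family_def by blast
    moreover have "return_set T x B \<subseteq> return_set T x U"
      using B(2) unfolding return_set_def by blast
    ultimately show "return_set T x U \<in> \<A>"
      using upper unfolding upper_furstenberg_family_def furstenberg_family_def by blast
  qed
  ultimately show ?thesis
    unfolding residual_def
    by (intro exI[of _ "(\<lambda>(B, \<mu>). G B \<mu>) ` (\<B> \<times> M)"]) auto
qed

lemma residual_imp_nonempty:
  fixes R :: "'x::complete_space set"
  assumes "residual R"
  shows "R \<noteq> {}"
proof -
  obtain \<G> where \<G>: "countable \<G>" "\<And>G. G \<in> \<G> \<Longrightarrow> open G \<and> closure G = UNIV" "\<Inter>\<G> \<subseteq> R"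
    using assms unfolding residual_def by blast
  have "closure (\<Inter>\<G>) = UNIV"
    using Baire_category[of "euclidean :: 'x topology" \<G>] \<G>(1,2) completely_metrizable_space_euclidean
    by auto
  then show ?thesis
    using \<G>(3) by auto
qed

text \<open>
  This is where left-invariance meets dynamics: shifting the return set is the same as moving the
  starting point along its orbit.
\<close>
lemma return_set_funpow_shift:
  "return_set (\<lambda>n. S ^^ n) ((S ^^ m) x) V = left_shift (return_set (\<lambda>n. S ^^ n) x V) m"
proof (intro set_eqI)
  fix k
  have "k \<in> left_shift A m \<longleftrightarrow> k + m \<in> A" for A
    unfolding left_shift_def by (auto intro: exI[of _ "k + m"])
  then show "k \<in> return_set (\<lambda>n. S ^^ n) ((S ^^ m) x) V \<longleftrightarrow>
      k \<in> left_shift (return_set (\<lambda>n. S ^^ n) x V) m"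
    by (simp add: return_set_def funpow_add)
qed

lemma universal_point_funpow_imp_hits_subfamily:
  fixes S :: "'x::topological_space \<Rightarrow> 'x"
  assumes upper: "upper_furstenberg_family D M \<F> \<A>"
    and x: "universal_point \<A> (\<lambda>n. S ^^ n) x"
  shows "hits_subfamily D M \<F> (\<lambda>n. S ^^ n)"
  unfolding hits_subfamily_def
proof (intro allI impI)
  let ?T = "\<lambda>n. S ^^ n"
  fix V :: "'x set" assume "open V \<and> V \<noteq> {}"
  then have "return_set ?T x V \<in> \<A>"
    using x unfolding universal_point_def by blast
  then obtain \<delta> where \<delta>: "\<delta> \<in> D" "\<And>m. left_shift (return_set ?T x V) m \<in> subfamily M \<F> \<delta>"
    using upper unfolding upper_furstenberg_family_def by blast
  have "\<exists>y\<in>U. return_set ?T y V \<in> subfamily M \<F> \<delta>" if "open U \<and> U \<noteq> {}" for U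
  proof -
    have "return_set ?T x U \<in> \<A>"
      using x that unfolding universal_point_def by blast
    then have "return_set ?T x U \<noteq> {}"
      using upper unfolding upper_furstenberg_family_def proper_family_def by metis
    then obtain m where "(S ^^ m) x \<in> U"
      unfolding return_set_def by blast
    with \<delta>(2) show ?thesis
      using return_set_funpow_shift[of S m x V] by metis
  qed
  with \<delta>(1) show "\<exists>\<delta>\<in>D. \<forall>U. open U \<and> U \<noteq> {} \<longrightarrow>
      (\<exists>y\<in>U. return_set ?T y V \<in> subfamily M \<F> \<delta>)"
    by blast
qed

lemma continuous_on_UNIV_funpow:
  fixes S :: "'x::topological_space \<Rightarrow> 'x"
  assumes "continuous_on UNIV S"
  shows "continuous_on UNIV (S ^^ n)"
proof (induction n)
  case (Suc n)
  then show ?case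
    using continuous_on_compose[OF Suc] continuous_on_subset[OF assms] by auto
qed auto

theorem theorem15:
  fixes D :: "'d set" and M :: "'m set"
    and \<F> :: "'d \<Rightarrow> 'm \<Rightarrow> nat set set" and \<A> :: "nat set set"
  assumes "upper_furstenberg_family D M \<F> \<A>"
  shows
    "(\<forall>T :: nat \<Rightarrow> 'x::complete_space \<Rightarrow> 'y::metric_space.
        separable_space (euclidean :: 'y topology) \<and> (\<forall>n. continuous_on UNIV (T n)) \<longrightarrow>
          (hits_subfamily D M \<F> T \<longrightarrow> hits_components D M \<F> T) \<and>
          (hits_components D M \<F> T \<longrightarrow> residual {x. universal_point \<A> T x}) \<and>
          (residual {x. universal_point \<A> T x} \<longrightarrow> (\<exists>x. universal_point \<A> T x))) \<and>
     (\<forall>S :: 'x \<Rightarrow> 'x.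
        separable_space (euclidean :: 'x topology) \<and> continuous_on UNIV S \<longrightarrow>
          (let T = (\<lambda>n. S ^^ n) in
            (hits_subfamily D M \<F> T \<longleftrightarrow> hits_components D M \<F> T) \<and>
            (hits_components D M \<F> T \<longleftrightarrow> residual {x. universal_point \<A> T x}) \<and>
            (residual {x. universal_point \<A> T x} \<longleftrightarrow> (\<exists>x. universal_point \<A> T x))))"
proof (intro conjI allI impI, goal_cases)
  case (1 T)
  show ?case
    using \<open>hits_subfamily D M \<F> T\<close> by (rule hits_subfamily_imp_hits_components)
next
  case (2 T)
  then show ?case
    using hits_components_imp_residual_universal[OF assms] by blast
next
  case (3 T)
  then show ?case
    using residual_imp_nonempty by blast
next
  case (4 S)
  let ?T = "\<lambda>n. S ^^ n"
  have "hits_subfamily D M \<F> ?T \<longrightarrow> hits_components D M \<F> ?T"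
    using hits_subfamily_imp_hits_components by blast
  moreover have "hits_components D M \<F> ?T \<longrightarrow> residual {x. universal_point \<A> ?T x}"
    using 4 continuous_on_UNIV_funpow[of S]
    by (intro impI hits_components_imp_residual_universal[OF assms]) auto
  moreover have "residual {x. universal_point \<A> ?T x} \<longrightarrow> (\<exists>x. universal_point \<A> ?T x)"
    using residual_imp_nonempty by blast
  moreover have "(\<exists>x. universal_point \<A> ?T x) \<longrightarrow> hits_subfamily D M \<F> ?T"
    using universal_point_funpow_imp_hits_subfamily[OF assms] by blast
  ultimately show ?case
    unfolding Let_def by argo
qed

end
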